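(* Let $d\ge2$ and let $F\subset\mathbb{R}^d$ be a self-similar fractal necklace with a necklace iterated function system $\{f_1,\dots,f_n\}$ of similitudes satisfying the open set condition. If $F$ is stable, then $F$ has no cut points.
   Context: Let $d\ge2$ and $I=\{1,2,\dots,n\}$. For $k\in I$ let $f_k:\mathbb{R}^d\to\mathbb{R}^d$ be contractive, i.e. $|f_k(x)-f_k(y)|\le c_k|x-y|$ for all $x,y$, with some $c_k\in(0,1)$. The attractor of the iterated function system (IFS) $\{f_1,\dots,f_n\}$ is the unique nonempty compact set $F\subset\mathbb{R}^d$ with $F=\bigcup_{k=1}^n f_k(F)$. Fractal necklace: $F$ is called a (fractal) necklace, and the ordered family $\{f_1,\dots,f_n\}$ a necklace IFS, if $n\ge3$, every $f_k$ is a contractive homeomorphism of $\mathbb{R}^d$ onto itself, and for each pair of distinct $m,k\in I$: $f_m(F)\cap f_k(F)$ is a singleton if $|m-k|=1$ or $|m-k|=n-1$, and $f_m(F)\cap f_k(F)=\emptyset$ if $2\le|m-k|\le n-2$. The necklace is self-similar if every $f_k$ is a similitude, i.e. $|f_k(x)-f_k(y)|=c_k|x-y|$ for all $x,y$ with some $c_k\in(0,1)$. Notation: $F_k=f_k(F)$ and $F_{kj}=f_k(f_j(F))$ for $k,j\in I$; $\partial_F A$ is the boundary of $A\subset F$ in the relative topology of $F$. Stable: $F$ is stable if for each $k\in I$ the set of sets $\{F_{kj}: j\in I,\ F_{kj}\cap\partial_F F_k\ne\emptyset\}$ has at least $2$ elements. Open set condition (OSC): there is a nonempty bounded open set $V\subset\mathbb{R}^d$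 such that $f_1(V),\dots,f_n(V)$ are pairwise disjoint open subsets of $V$. Cut point: a point $x$ of a connected topological space $X$ is a cut point of $X$ if $X\setminus\{x\}$ is not connected. (Every fractal necklace is connected.) *)

theory Defs
  imports "HOL-Analysis.Analysis"
begin

definition contractive :: "('a::metric_space \<Rightarrow> 'a) \<Rightarrow> bool" where
  "contractive f \<longleftrightarrow> (\<exists>c. 0 < c \<and> c < 1 \<and> (\<forall>x y. dist (f x) (f y) \<le> c * dist x y))"

definition similitude :: "('a::metric_space \<Rightarrow> 'a) \<Rightarrow> bool" where
  "similitude f \<longleftrightarrow> (\<exists>c. 0 < c \<and> c < 1 \<and> (\<forall>x y. dist (f x) (f y) = c * dist x y))"

text \<open>
  An iterated function system is a family \<open>f 1, \<dots>, f n\<close>; values of \<open>f\<close> outside \<open>{1..n}\<close> are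
  irrelevant. For contractive maps of a Euclidean space the set \<open>F\<close> below exists and is unique.
\<close>

definition is_attractor :: "nat \<Rightarrow> (nat \<Rightarrow> 'a::metric_space \<Rightarrow> 'a) \<Rightarrow> 'a set \<Rightarrow> bool" where
  "is_attractor n f F \<longleftrightarrow> F \<noteq> {} \<and> compact F \<and> F = (\<Union>k\<in>{1..n}. f k ` F)"

text \<open>Index distances are taken in \<open>int\<close>, since subtraction on \<open>nat\<close> truncates.\<close>

definition necklace_IFS :: "nat \<Rightarrow> (nat \<Rightarrow> 'a::metric_space \<Rightarrow> 'a) \<Rightarrow> 'a set \<Rightarrow> bool" where
  "necklace_IFS n f F \<longleftrightarrow>
     3 \<le> n \<and>
     (\<forall>k\<in>{1..n}. contractive (f k) \<and> (\<exists>g. homeomorphism UNIV UNIV (f k) g)) \<and>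
     is_attractor n f F \<and>
     (\<forall>m\<in>{1..n}. \<forall>k\<in>{1..n}. m \<noteq> k \<longrightarrow>
        (\<bar>int m - int k\<bar> = 1 \<or> \<bar>int m - int k\<bar> = int n - 1 \<longrightarrow>
           is_singleton (f m ` F \<inter> f k ` F)) \<and>
        (2 \<le> \<bar>int m - int k\<bar> \<and> \<bar>int m - int k\<bar> \<le> int n - 2 \<longrightarrow>
           f m ` F \<inter> f k ` F = {}))"

definition self_similar_necklace_IFS ::
  "nat \<Rightarrow> (nat \<Rightarrow> 'a::metric_space \<Rightarrow> 'a) \<Rightarrow> 'a set \<Rightarrow> bool" where
  "self_similar_necklace_IFS n f F \<longleftrightarrow> necklace_IFS n f F \<and> (\<forall>k\<in>{1..n}. similitude (f k))"

text \<open>The elements counted are the sets \<open>f k ` f j ` F\<close> themselves, not the indices \<open>j\<close>.\<close>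

definition stable_necklace :: "nat \<Rightarrow> (nat \<Rightarrow> 'a::metric_space \<Rightarrow> 'a) \<Rightarrow> 'a set \<Rightarrow> bool" where
  "stable_necklace n f F \<longleftrightarrow>
     (\<forall>k\<in>{1..n}.
        2 \<le> card {f k ` f j ` F | j.
                    j \<in> {1..n} \<and> f k ` f j ` F \<inter> (top_of_set F frontier_of f k ` F) \<noteq> {}})"

definition open_set_condition :: "nat \<Rightarrow> (nat \<Rightarrow> 'a::metric_space \<Rightarrow> 'a) \<Rightarrow> bool" where
  "open_set_condition n f \<longleftrightarrow>
     (\<exists>V. V \<noteq> {} \<and> bounded V \<and> open V \<and>
          (\<forall>k\<in>{1..n}. open (f k ` V) \<and> f k ` V \<subseteq> V) \<and>
          disjoint_family_on (\<lambda>k. f k ` V) {1..n})"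

text \<open>Meant for connected \<open>X\<close>; connectedness of \<open>X\<close> is deliberately not part of the definition,
  so that the absence of cut points cannot hold vacuously for a disconnected set.\<close>

definition is_cut_point :: "'a::topological_space \<Rightarrow> 'a set \<Rightarrow> bool" where
  "is_cut_point x X \<longleftrightarrow> x \<in> X \<and> \<not> connected (X - {x})"

end

theory Submission
  imports Defs
begin

text \<open>
  Write \<open>G x\<close> for connectedness of \<open>F - {x}\<close> and call \<open>f k ` F\<close> the pieces of \<open>F\<close>.

  The pieces form a closed ring in which neighbours touch in one point, a contact. Removing one point \<open>x\<close> from
  the ring destroys at most one of the contacts, provided that no point lies on three pieces. So
  if every piece containing \<open>x\<close> stays connected when \<open>x\<close> is removed, then \<open>F - {x}\<close> is a chain
  of connected sets and is connected: \<open>G x\<close> follows from \<open>G y\<close> for all \<open>y \<in> F\<close> that some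
  \<open>f k\<close> sends to \<open>x\<close> (\<open>connected_delete_if_pieces\<close>). Triple points occur only for \<open>n = 3\<close> with all
  three contacts equal; stability makes such a point fixed by all \<open>f k\<close>, and \<open>F\<close> would be a single
  point (\<open>stable_no_triple_point\<close>).

  Consequently a cut point \<open>x\<close> starts an infinite path of cut points \<open>x 0, x 1, \<dots>\<close> with
  \<open>x 0 = x\<close> and \<open>x m = f (\<kappa> m) (x (m + 1))\<close>. Two facts about such paths are incompatible with it.

  A path can meet a contact only finitely often (\<open>finitely_many_branchings\<close>). Each
  time \<open>x m\<close> also lies on a piece other than \<open>f (\<kappa> m) ` F\<close>, the point \<open>x 0\<close> acquires a
  further address that splits off from the path. After prolonging the addresses to a common
  size \<open>r\<close>, the images of the open set of the open set condition under the corresponding compositions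
  are disjoint; each contains a ball of radius comparable to \<open>r\<close>, centred within a
  multiple of \<open>r\<close> of \<open>x 0\<close>. Only boundedly many such balls fit.

  Past the last contact, \<open>x m\<close> lies only on the piece \<open>f (\<kappa> m) ` F\<close>, and then \<open>G\<close>
  holds (\<open>nonbranching_path_connected_delete\<close>). For suppose that \<open>F - {x m}\<close> has a nonempty
  clopen part \<open>D\<close> disjoint from the union of the other pieces. It lies in \<open>f (\<kappa> m) ` F\<close>, so it
  pulls back to a clopen part of \<open>F - {x (m + 1)}\<close>. Stability says that the two contacts of
  \<open>f (\<kappa> m) ` F\<close> are not both reached through one and the same second-level piece only; hence the pull-back
  misses a point of the connected union of the pieces other than \<open>f (\<kappa> (m + 1)) ` F\<close>, and so all
  of it. Each pull-back multiplies the distances to the removed point by at least \<open>1 / b > 1\<close>,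
  where \<open>b\<close> is the largest ratio, which is impossible in the bounded set \<open>F\<close>.
\<close>

section \<open>Chains, packings and expanding distances\<close>

lemma connected_chain:
  assumes "\<And>i. i \<le> m \<Longrightarrow> connected (E i)"
    and "\<And>i. i < m \<Longrightarrow> E i \<inter> E (Suc i) \<noteq> {}"
  shows "connected (\<Union>i\<le>m::nat. E i)"
  using assms
proof (induction m)
  case 0
  then show ?case by simp
next
  case (Suc m)
  have "connected (\<Union>i\<le>m. E i)"
    using Suc.IH Suc.prems by simp
  moreover have "(\<Union>i\<le>m. E i) \<inter> E (Suc m) \<noteq> {}"
    using Suc.prems(2)[of m] by blast
  ultimately have "connected ((\<Union>i\<le>m. E i) \<union> E (Suc m))"
    using Suc.prems(1)[of "Suc m"] by (intro connected_Un) auto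
  then show ?case
    by (simp add: atMost_Suc Un_commute)
qed

text \<open>Total boundedness in the form of a packing bound: cover \<open>K\<close> by finitely many balls of radius
  \<open>\<epsilon>/2\<close>; no ball contains two of the separated points.\<close>

lemma compact_separated_card_bounded:
  fixes K :: "'a::metric_space set"
  assumes "compact K" and "0 < \<epsilon>"
  obtains M where "\<And>T g. \<lbrakk>finite T; \<And>s. s \<in> T \<Longrightarrow> g s \<in> K;
      \<And>s t. \<lbrakk>s \<in> T; t \<in> T; s \<noteq> t\<rbrakk> \<Longrightarrow> \<epsilon> \<le> dist (g s) (g t)\<rbrakk> \<Longrightarrow> card (T::nat set) \<le> M"
proof -
  obtain S where S: "finite S" "K \<subseteq> (\<Union>x\<in>S. ball x (\<epsilon>/2))"
    using seq_compact_imp_totally_bounded[of K] assms by (metis compact_eq_seq_compact_metric half_gt_zero)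
  show thesis
  proof (rule that[of "card S"])
    fix T :: "nat set" and g
    assume "finite T" and gK: "\<And>s. s \<in> T \<Longrightarrow> g s \<in> K"
      and sep: "\<And>s t. \<lbrakk>s \<in> T; t \<in> T; s \<noteq> t\<rbrakk> \<Longrightarrow> \<epsilon> \<le> dist (g s) (g t)"
    have "\<forall>s\<in>T. \<exists>x\<in>S. dist x (g s) < \<epsilon>/2"
      using gK S(2) by fastforce
    then obtain h where h: "\<And>s. s \<in> T \<Longrightarrow> h s \<in> S \<and> dist (h s) (g s) < \<epsilon>/2"
      by metis
    have "inj_on h T"
    proof (rule inj_onI, rule ccontr)
      fix s t assume st: "s \<in> T" "t \<in> T" "h s = h t" "s \<noteq> t"
      have "dist (g s) (g t) < \<epsilon>"
        using h[OF st(1)] h[OF st(2)] st(3) by (metis dist_commute dist_triangle_half_r)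
      then show False using sep[OF st(1,2,4)] by simp
    qed
    then show "card T \<le> card S"
      using h S(1) by (intro card_inj_on_le[of h]) auto
  qed
qed

lemma bounded_expanding_False:
  fixes S :: "'a::metric_space set" and b \<delta> :: real
  assumes "bounded S" "0 < b" "b < 1" "0 < \<delta>"
    and far: "\<And>m. \<exists>x\<in>S. \<exists>y\<in>S. \<delta> / b ^ m \<le> dist x y"
  shows False
proof -
  obtain e where e: "\<And>x y. x \<in> S \<Longrightarrow> y \<in> S \<Longrightarrow> dist x y \<le> e" "0 \<le> e"
    using diameter_bounded_bound[OF assms(1)] diameter_ge_0[OF assms(1)] by metis
  obtain m where "b ^ m < \<delta> / (e + 1)"
    using real_arch_pow_inv[of "\<delta> / (e + 1)" b] assms(3,4) e(2) by auto
  then have "(e + 1) * b ^ m < \<delta>"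
    using e(2) by (simp add: field_simps)
  moreover have "e * b ^ m \<le> (e + 1) * b ^ m"
    using assms(2) by (intro mult_right_mono) auto
  ultimately have "e * b ^ m < \<delta>" by linarith
  then have "e < \<delta> / b ^ m"
    using assms(2) by (simp add: pos_less_divide_eq)
  then show False using far[of m] e(1) by fastforce
qed

section \<open>The ring of pieces\<close>

text \<open>The hypotheses on a self-similar necklace, with the contraction ratios \<open>c k\<close> named.\<close>

locale similarity_necklace =
  fixes n :: nat and f :: "nat \<Rightarrow> 'a::euclidean_space \<Rightarrow> 'a" and F :: "'a set" and c :: "nat \<Rightarrow> real"
  assumes three_le: "3 \<le> n"
    and ratio_pos: "k \<in> {1..n} \<Longrightarrow> 0 < c k"
    and ratio_less: "k \<in> {1..n} \<Longrightarrow> c k < 1"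
    and dist_f: "k \<in> {1..n} \<Longrightarrow> dist (f k x) (f k y) = c k * dist x y"
    and surj_f: "k \<in> {1..n} \<Longrightarrow> surj (f k)"
    and F_nonempty: "F \<noteq> {}"
    and compact_F: "compact F"
    and F_eq: "F = (\<Union>k\<in>{1..n}. f k ` F)"
    and adjacent: "\<lbrakk>m \<in> {1..n}; k \<in> {1..n}; \<bar>int m - int k\<bar> = 1 \<or> \<bar>int m - int k\<bar> = int n - 1\<rbrakk>
      \<Longrightarrow> is_singleton (f m ` F \<inter> f k ` F)"
    and nonadjacent: "\<lbrakk>m \<in> {1..n}; k \<in> {1..n}; 2 \<le> \<bar>int m - int k\<bar>; \<bar>int m - int k\<bar> \<le> int n - 2\<rbrakk>
      \<Longrightarrow> f m ` F \<inter> f k ` F = {}"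
begin

definition other_pieces :: "nat \<Rightarrow> 'a set" where
  "other_pieces k = (\<Union>j\<in>{1..n} - {k}. f j ` F)"

text \<open>The indices \<open>1, \<dots>, n\<close> repeated periodically, starting with \<open>cyc 0 = 1\<close>; this lets the ring be
  read as a sequence from any starting place.\<close>

definition cyc :: "nat \<Rightarrow> nat" where
  "cyc i = Suc (i mod n)"

lemma cyc_in: "cyc i \<in> {1..n}"
  using three_le by (simp add: cyc_def Suc_leI)

lemma inj_f: "k \<in> {1..n} \<Longrightarrow> inj (f k)"
  by (metis dist_f dist_eq_0_iff injI mult_eq_0_iff ratio_pos less_irrefl)

lemma continuous_f: "k \<in> {1..n} \<Longrightarrow> continuous_on S (f k)"
proof -
  assume k: "k \<in> {1..n}"
  have "(c k)-lipschitz_on S (f k)"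
    using k ratio_pos[OF k] by (intro lipschitz_onI) (auto simp: dist_f)
  then show ?thesis by (rule lipschitz_on_continuous_on)
qed

lemma mem_F_iff: "x \<in> F \<longleftrightarrow> (\<exists>k\<in>{1..n}. x \<in> f k ` F)"
  using arg_cong[OF F_eq, of "\<lambda>S. x \<in> S"] by (simp only: UN_iff)

lemma piece_subset: "k \<in> {1..n} \<Longrightarrow> f k ` F \<subseteq> F"
  using mem_F_iff by blast

lemma other_pieces_subset: "other_pieces k \<subseteq> F"
  unfolding other_pieces_def using piece_subset by blast

lemma F_split: "k \<in> {1..n} \<Longrightarrow> F = f k ` F \<union> other_pieces k"
  unfolding other_pieces_def set_eq_iff Un_iff UN_iff using mem_F_iff by blast

lemma closed_piece: "k \<in> {1..n} \<Longrightarrow> closed (f k ` F)"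
  by (intro compact_imp_closed compact_continuous_image continuous_f compact_F)

lemma closed_other_pieces: "closed (other_pieces k)"
  unfolding other_pieces_def using closed_piece by (intro closed_UN) auto

lemma ratio_bounds:
  obtains a b where "0 < a" "b < 1" "0 < b" "\<And>k. k \<in> {1..n} \<Longrightarrow> a \<le> c k \<and> c k \<le> b"
proof
  have ne: "c ` {1..n} \<noteq> {}" using three_le by simp
  show "0 < Min (c ` {1..n})" using ne ratio_pos by simp
  show "Max (c ` {1..n}) < 1" using ne ratio_less by simp
  have "1 \<in> {1..n}" using three_le by simp
  then show "0 < Max (c ` {1..n})" 
    using ratio_pos[of 1] by (meson Max_ge finite_atLeastAtMost finite_imageI imageI less_le_trans)
  show "Min (c ` {1..n}) \<le> c k \<and> c k \<le> Max (c ` {1..n})" if "k \<in> {1..n}" for k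
    using that by simp
qed

lemma cyc_meet: "f (cyc i) ` F \<inter> f (cyc (Suc i)) ` F \<noteq> {}"
proof -
  have "\<bar>int (cyc i) - int (cyc (Suc i))\<bar> = 1 \<or> \<bar>int (cyc i) - int (cyc (Suc i))\<bar> = int n - 1"
    using three_le by (auto simp: cyc_def mod_Suc)
  from adjacent[OF cyc_in cyc_in this] show ?thesis
    by (auto simp: is_singleton_def)
qed

lemma cyc_inj: "cyc (s + i) = cyc (s + j) \<Longrightarrow> i < n \<Longrightarrow> j < n \<Longrightarrow> i = j"
proof (induction i j rule: linorder_wlog)
  case (le i j)
  then have "n dvd (s + j) - (s + i)"
    by (metis cyc_def mod_eq_dvd_iff_nat nat_add_left_cancel_le old.nat.inject)
  then have "n dvd j - i" by simp
  then show ?case using le by (meson diff_is_0_eq dvd_imp_le le_antisym less_imp_diff_less not_le zero_less_iff_neq_zero)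
qed auto

lemma cyc_range: "(\<lambda>i. cyc (s + i)) ` {..<n} = {1..n}"
proof (rule card_subset_eq)
  show "(\<lambda>i. cyc (s + i)) ` {..<n} \<subseteq> {1..n}" using cyc_in by blast
  have "inj_on (\<lambda>i. cyc (s + i)) {..<n}" using cyc_inj by (auto intro!: inj_onI)
  then show "card ((\<lambda>i. cyc (s + i)) ` {..<n}) = card {1..n}" by (simp add: card_image)
qed simp

lemma meeting_adjacent:
  assumes "k \<in> {1..n}" "l \<in> {1..n}" "k \<noteq> l" "f k ` F \<inter> f l ` F \<noteq> {}"
  shows "\<bar>int k - int l\<bar> = 1 \<or> \<bar>int k - int l\<bar> = int n - 1"
proof -
  have "\<not> (2 \<le> \<bar>int k - int l\<bar> \<and> \<bar>int k - int l\<bar> \<le> int n - 2)"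
    using nonadjacent[OF assms(1,2)] assms(4) by blast
  moreover have "1 \<le> \<bar>int k - int l\<bar>" "\<bar>int k - int l\<bar> \<le> int n - 1"
    using assms(1-3) by auto
  ultimately show ?thesis by linarith
qed

text \<open>If \<open>x\<close> is the contact of two pieces, the ring can be read so that these come first and last:
  the contact at \<open>x\<close> is then not used by the chain.\<close>

lemma cyc_pair:
  assumes "k \<in> {1..n}" "l \<in> {1..n}" "k \<noteq> l" "f k ` F \<inter> f l ` F \<noteq> {}"
  obtains s where "{k, l} = {cyc s, cyc (s + (n - 1))}"
proof -
  have adj: "\<bar>int k - int l\<bar> = 1 \<or> \<bar>int k - int l\<bar> = int n - 1"
    by (rule meeting_adjacent[OF assms])
  have *: "{i, Suc i} = {cyc i, cyc (i + (n - 1))}" if "i \<in> {1..n}" "Suc i \<in> {1..n}" for i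
  proof -
    have "i + (n - 1) = (i - 1) + n" using that by simp
    then have "(i + (n - 1)) mod n = (i - 1) mod n" by simp
    then show ?thesis using that by (auto simp: cyc_def)
  qed
  consider "l = Suc k" | "k = Suc l" | "k = 1 \<and> l = n \<or> k = n \<and> l = 1"
    using adj assms by auto linarith+
  then show thesis
  proof cases
    case 1 then show ?thesis using that[of k] * assms by blast
  next
    case 2 then show ?thesis using that[of l] * assms by blast
  next
    case 3
    have "{1, n} = {cyc 0, cyc (0 + (n - 1))}" using three_le by (auto simp: cyc_def)
    then show ?thesis using 3 that[of 0] by blast
  qed
qed

text \<open>Neighbouring pieces meet, so the decision for one piece passes around the whole ring.\<close>

lemma piecewise_decided_subset:
  assumes "\<And>k. k \<in> {1..n} \<Longrightarrow> f k ` F \<subseteq> C \<or> f k ` F \<inter> C = {}" 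
  shows "F \<subseteq> C \<or> F \<inter> C = {}"
proof -
  have "(f (cyc i) ` F \<subseteq> C) = (f (cyc 0) ` F \<subseteq> C)" for i
  proof (induction i)
    case (Suc i)
    then show ?case
      using assms[OF cyc_in[of i]] assms[OF cyc_in[of "Suc i"]] cyc_meet[of i] by blast
  qed simp
  then have "f k ` F \<subseteq> C \<longleftrightarrow> f (cyc 0) ` F \<subseteq> C" if "k \<in> {1..n}" for k
  proof -
    have "k \<in> (\<lambda>i. cyc (0 + i)) ` {..<n}" using that unfolding cyc_range .
    then obtain i where "k = cyc i" by auto
    then show ?thesis using \<open>\<And>i. (f (cyc i) ` F \<subseteq> C) = (f (cyc 0) ` F \<subseteq> C)\<close> by simp
  qed
  then have "(\<forall>k\<in>{1..n}. f k ` F \<subseteq> C) \<or> (\<forall>k\<in>{1..n}. f k ` F \<inter> C = {})"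
    using assms by metis
  then have "(\<Union>k\<in>{1..n}. f k ` F) \<subseteq> C \<or> (\<Union>k\<in>{1..n}. f k ` F) \<inter> C = {}"
    by blast
  then show ?thesis unfolding F_eq[symmetric] .
qed

text \<open>A splitting of \<open>F\<close> into two parts with gap \<open>\<delta>\<close> must split some piece; magnified to \<open>F\<close>, that piece
  is a splitting of \<open>F\<close> with gap at least \<open>\<delta> / b\<close>, where \<open>b < 1\<close> bounds the ratios. Iteration makes the gap exceed
  the diameter.\<close>

lemma connected_F: "connected F"
proof (rule ccontr)
  assume "\<not> connected F"
  then obtain A B where AB: "closed A" "closed B" "A \<noteq> {}" "B \<noteq> {}" "A \<union> B = F" "A \<inter> B = {}"
    using connected_closed_set[OF compact_imp_closed[OF compact_F]] by metis
  obtain a b where ab: "b < 1" "0 < b" "\<And>k. k \<in> {1..n} \<Longrightarrow> a \<le> c k \<and> c k \<le> b"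
    using ratio_bounds by metis
  have "F \<inter> A = A" using AB(5) by blast
  then have "compact A"
    using compact_Int_closed[OF compact_F AB(1)] by simp
  then obtain \<delta> where \<delta>: "\<delta> > 0" "\<And>x y. x \<in> A \<Longrightarrow> y \<in> B \<Longrightarrow> \<delta> \<le> dist x y"
    using separate_compact_closed[of A B] AB(2,6) by metis
  have gap: "\<exists>C x y. x \<in> C \<inter> F \<and> y \<in> F - C \<and> (\<forall>x\<in>C \<inter> F. \<forall>y\<in>F - C. \<delta> / b ^ m \<le> dist x y)" for m
  proof (induction m)
    case 0
    show ?case proof -
      have "A \<inter> F = A" "F - A = B" using AB(5,6) by blast+
      then show ?thesis using AB(3,4) \<delta>(2) by (intro exI[of _ A]) auto
    qed
  next
    case (Suc m)
    then obtain C x y where C: "x \<in> C \<inter> F" "y \<in> F - C"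
      "\<And>x y. x\<in>C \<inter> F \<Longrightarrow> y\<in>F - C \<Longrightarrow> \<delta> / b ^ m \<le> dist x y" by blast
    have "\<not> (F \<subseteq> C \<or> F \<inter> C = {})" using C(1,2) by blast
    then obtain k where k: "k \<in> {1..n}" "\<not> (f k ` F \<subseteq> C \<or> f k ` F \<inter> C = {})"
      using piecewise_decided_subset[of C] by blast
    then obtain u v where uv: "u \<in> F" "f k u \<in> C" "v \<in> F" "f k v \<notin> C" by blast
    have "\<delta> / b ^ Suc m \<le> dist x' y'" if "x' \<in> f k -` C \<inter> F" "y' \<in> F - f k -` C" for x' y'
    proof -
      have "\<delta> / b ^ m \<le> dist (f k x') (f k y')"
        using that piece_subset[OF k(1)] by (intro C(3)) auto
      also have "\<dots> \<le> b * dist x' y'"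
        using k ab by (simp add: dist_f mult_right_mono)
      finally show ?thesis using ab by (simp add: field_simps)
    qed
    then show ?case using uv by (intro exI[of _ "f k -` C"] exI[of _ u] exI[of _ v]) auto
  qed
  show False
    by (rule bounded_expanding_False[OF compact_imp_bounded[OF compact_F] \<open>0 < b\<close> \<open>b < 1\<close> \<delta>(1)])
      (use gap in blast)
qed

lemma connected_piece: "k \<in> {1..n} \<Longrightarrow> connected (f k ` F)"
  by (intro connected_continuous_image continuous_f connected_F)

lemma connected_other_pieces: assumes "k \<in> {1..n}" shows "connected (other_pieces k)"
proof -
  define E where "E i = f (cyc (k + i)) ` F" for i
  have con: "connected (\<Union>i\<le>n - 2. E i)"
  proof (rule connected_chain)
    show "connected (E i)" for i using connected_piece cyc_in by (simp add: E_def)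
    show "E i \<inter> E (Suc i) \<noteq> {}" for i using cyc_meet[of "k + i"] by (simp add: E_def)
  qed
  have last: "cyc (k + (n - 1)) = k"
  proof -
    have "k + (n - 1) = (k - 1) + n" using assms by simp
    then have "(k + (n - 1)) mod n = (k - 1) mod n" by simp
    then show ?thesis using assms by (auto simp: cyc_def)
  qed
  have "(\<lambda>i. cyc (k + i)) ` {..n - 2} = {1..n} - {k}"
  proof -
    have "{..<n} = insert (n - 1) {..n - 2}" using three_le by auto
    then have "{1..n} = insert k ((\<lambda>i. cyc (k + i)) ` {..n - 2})"
      using cyc_range[of k] last by simp
    moreover have "k \<notin> (\<lambda>i. cyc (k + i)) ` {..n - 2}"
      using cyc_inj[of k "n - 1"] last three_le by fastforce
    ultimately show ?thesis by blast
  qed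
  moreover have "(\<Union>i\<le>n - 2. E i) = (\<Union>j\<in>(\<lambda>i. cyc (k + i)) ` {..n - 2}. f j ` F)"
    by (simp add: E_def)
  ultimately show ?thesis using con unfolding other_pieces_def by simp
qed

section \<open>Consequences of stability\<close>

text \<open>The relative boundary of a piece lies in the other pieces, because these form a closed set that covers its
  complement in \<open>F\<close>.\<close>

lemma stable_necklace_meets:
  assumes "stable_necklace n f F" "k \<in> {1..n}"
  obtains i j y z where "i \<in> {1..n}" "j \<in> {1..n}" "f k ` f i ` F \<noteq> f k ` f j ` F"
    "y \<in> f i ` F" "f k y \<in> other_pieces k" "z \<in> f j ` F" "f k z \<in> other_pieces k"
proof -
  have fr: "top_of_set F frontier_of f k ` F \<subseteq> other_pieces k"
  proof -
    have "closedin (top_of_set F) (other_pieces k)"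
      using closed_other_pieces other_pieces_subset by (simp add: closed_subset)
    moreover have "F - f k ` F \<subseteq> other_pieces k" using F_split[OF assms(2)] by blast
    ultimately show ?thesis
      using closure_of_minimal[of "F - f k ` F" "other_pieces k" "top_of_set F"]
      by (auto simp: frontier_of_closures)
  qed
  let ?S = "{f k ` f j ` F | j. j \<in> {1..n} \<and> f k ` f j ` F \<inter> (top_of_set F frontier_of f k ` F) \<noteq> {}}"
  have "2 \<le> card ?S" using assms by (simp add: stable_necklace_def)
  then obtain U where U: "U \<subseteq> ?S" "card U = 2"
    using obtain_subset_with_card_n by meson
  then obtain S T where ST: "S \<in> ?S" "T \<in> ?S" "S \<noteq> T"
    by (metis (no_types, lifting) card_2_iff insert_subset)
  from ST(1) fr obtain i y where "i \<in> {1..n}" "S = f k ` f i ` F" "y \<in> f i ` F" "f k y \<in> other_pieces k"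
    by blast
  moreover from ST(2) fr obtain j z where "j \<in> {1..n}" "T = f k ` f j ` F" "z \<in> f j ` F" "f k z \<in> other_pieces k"
    by blast
  ultimately show thesis using that ST(3) by blast
qed

text \<open>One of the two second-level pieces provided by stability has its second index different from
  \<open>l\<close>.\<close>

lemma stable_reaches_other_pieces:
  assumes "stable_necklace n f F" "k \<in> {1..n}"
  shows "\<exists>y\<in>other_pieces l. f k y \<in> other_pieces k"
proof -
  obtain i j y z where ij: "i \<in> {1..n}" "j \<in> {1..n}" "f k ` f i ` F \<noteq> f k ` f j ` F"
    "y \<in> f i ` F" "f k y \<in> other_pieces k" "z \<in> f j ` F" "f k z \<in> other_pieces k"
    using stable_necklace_meets[OF assms] by metis
  then have "i \<noteq> l \<or> j \<noteq> l" by blast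
  then have "y \<in> other_pieces l \<or> z \<in> other_pieces l" using ij(1,2,4,6) unfolding other_pieces_def by blast
  then show ?thesis using ij(5,7) by blast
qed

text \<open>A point of \<open>F\<close> farthest from \<open>p\<close> is the image of a point that would be farther still.\<close>

lemma common_fixed_point:
  assumes "p \<in> F" "\<And>k. k \<in> {1..n} \<Longrightarrow> f k p = p"
  shows "F = {p}"
proof -
  obtain z where z: "z \<in> F" "\<And>y. y \<in> F \<Longrightarrow> dist p y \<le> dist p z"
    using distance_attains_sup[OF compact_F F_nonempty] by metis
  obtain k y where k: "k \<in> {1..n}" "y \<in> F" "z = f k y" using z(1) mem_F_iff by blast
  have "dist p z = c k * dist p y" using dist_f[OF k(1), of p y] assms(2)[OF k(1)] k by simp
  also have "\<dots> \<le> c k * dist p z" using z(2)[OF k(2)] ratio_pos[OF k(1)] by simp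
  finally have "(1 - c k) * dist p z \<le> 0" by (simp add: algebra_simps)
  then have "dist p z = 0"
    using ratio_less[OF k(1)] by (simp add: mult_le_0_iff)
  then have "p = y" if "y \<in> F" for y using z(2)[OF that] by simp
  then show ?thesis using assms(1) by blast
qed

text \<open>Three pairwise neighbouring indices force \<open>n = 3\<close>, and then any two pieces meet in \<open>p\<close>
  alone. Both second-level pieces given by stability then contain \<open>p\<close>, so the preimage of \<open>p\<close> under
  \<open>f k\<close> lies on two pieces and is \<open>p\<close> itself. A common fixed point means \<open>F = {p}\<close>, which
  leaves no two distinct second-level pieces.\<close>

lemma stable_no_triple_point:
  assumes st: "stable_necklace n f F"
    and ijl: "i \<in> {1..n}" "j \<in> {1..n}" "l \<in> {1..n}" "i \<noteq> j" "i \<noteq> l" "j \<noteq> l"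
  shows "f i ` F \<inter> f j ` F \<inter> f l ` F = {}"
proof (rule ccontr)
  assume "\<not> ?thesis"
  then obtain p where p: "p \<in> f i ` F" "p \<in> f j ` F" "p \<in> f l ` F" by blast
  have adj: "\<bar>int a - int b\<bar> = 1 \<or> \<bar>int a - int b\<bar> = int n - 1" 
    if "a \<in> {1..n}" "b \<in> {1..n}" "a \<noteq> b" "p \<in> f a ` F" "p \<in> f b ` F" for a b
    using meeting_adjacent[OF that(1-3)] that(4,5) by blast
  have n3: "n = 3"
    using adj[of i j] adj[of i l] adj[of j l] p ijl three_le by auto
  then have "{1..n} = {i, j, l}"
    using ijl by (intro card_subset_eq[symmetric]) auto
  then have all: "p \<in> f a ` F" if "a \<in> {1..n}" for a using p that by (metis insertE singletonD)
  have only: "x = p" if x: "a \<in> {1..n}" "b \<in> {1..n}" "a \<noteq> b" "x \<in> f a ` F" "x \<in> f b ` F" for a b x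
  proof -
    have "\<bar>int a - int b\<bar> = 1 \<or> \<bar>int a - int b\<bar> = int n - 1" using x n3 by auto
    from adjacent[OF x(1,2) this] obtain q where "f a ` F \<inter> f b ` F = {q}"
      by (auto simp: is_singleton_def)
    then show ?thesis using all[OF x(1)] all[OF x(2)] x(4,5) by (metis IntI singletonD)
  qed
  have fixes_p: "f k p = p" if k: "k \<in> {1..n}" for k
  proof -
    obtain a b y z where ab: "a \<in> {1..n}" "b \<in> {1..n}" "f k ` f a ` F \<noteq> f k ` f b ` F"
      "y \<in> f a ` F" "f k y \<in> other_pieces k" "z \<in> f b ` F" "f k z \<in> other_pieces k"
      using stable_necklace_meets[OF st k] by metis
    have eq: "f k u = p" if u: "u \<in> F" "f k u \<in> other_pieces k" for u
    proof -
      obtain j where j: "j \<in> {1..n}" "k \<noteq> j" "f k u \<in> f j ` F" using u(2) unfolding other_pieces_def by blast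
      show ?thesis by (rule only[OF k j(1,2) imageI[OF u(1)] j(3)])
    qed
    have "y \<in> F" "z \<in> F" using ab piece_subset by blast+
    then have "f k y = p" "f k z = p" using eq ab by auto
    moreover from this have "y = z" using inj_f[OF k] by (metis injD)
    moreover have "y = p" using only[of a b y] ab \<open>y = z\<close> by blast
    ultimately show ?thesis by simp
  qed
  have "p \<in> F" using p(1) piece_subset[OF ijl(1)] by blast
  then have Fp: "F = {p}" using common_fixed_point fixes_p by blast
  obtain a b where ab: "a \<in> {1..n}" "b \<in> {1..n}" "f i ` f a ` F \<noteq> f i ` f b ` F"
    using stable_necklace_meets[OF st ijl(1)] by metis
  have "f i ` f a ` F = f i ` f b ` F"
    unfolding Fp image_insert image_empty fixes_p[OF ab(1)] fixes_p[OF ab(2)] ..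
  then show False using ab(3) by blast
qed

text \<open>Start reading the ring so that no contact inside the chain is at \<open>x\<close>.\<close>

lemma connected_delete_if_pieces:
  assumes st: "stable_necklace n f F"
    and pieces: "\<And>k y. \<lbrakk>k \<in> {1..n}; y \<in> F; f k y = x\<rbrakk> \<Longrightarrow> connected (F - {y})"
  shows "connected (F - {x})"
proof -
  have con: "connected (f k ` F - {x})" if k: "k \<in> {1..n}" for k
  proof (cases "x \<in> f k ` F")
    case True
    then obtain y where y: "y \<in> F" "f k y = x" by blast
    have "f k ` F - {x} = f k ` (F - {y})"
      using inj_f[OF k] y by (auto dest: injD)
    then show ?thesis
      using pieces[OF k y] continuous_f[OF k] by (simp add: connected_continuous_image)
  qed (use connected_piece[OF k] in simp)
  obtain s where s: "\<And>i. i < n - 1 \<Longrightarrow>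
      \<not> (x \<in> f (cyc (s + i)) ` F \<and> x \<in> f (cyc (s + Suc i)) ` F)"
  proof (cases "\<exists>k l. k \<in> {1..n} \<and> l \<in> {1..n} \<and> k \<noteq> l \<and> x \<in> f k ` F \<and> x \<in> f l ` F")
    case True
    then obtain k l where kl: "k \<in> {1..n}" "l \<in> {1..n}" "k \<noteq> l" "x \<in> f k ` F" "x \<in> f l ` F" by blast
    then obtain s where s: "{k, l} = {cyc s, cyc (s + (n - 1))}"
      using cyc_pair[OF kl(1-3)] by blast
    \<comment> \<open>All pieces strictly inside the chain avoid \<open>x\<close>, and every contact of the chain involves one of them since \<open>3 \<le> n\<close>.\<close>
    have out: "x \<notin> f (cyc (s + i)) ` F" if "0 < i" "i < n - 1" for i
    proof -
      have "cyc (s + i) \<noteq> cyc (s + 0)" "cyc (s + i) \<noteq> cyc (s + (n - 1))"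
        using cyc_inj[of s i 0] cyc_inj[of s i "n - 1"] that by fastforce+
      then have "cyc (s + i) \<noteq> k" "cyc (s + i) \<noteq> l" using s by auto
      then show ?thesis
        using stable_no_triple_point[OF st kl(1,2) cyc_in kl(3), of "s + i"] kl by blast
    qed
    show thesis
    proof (rule that[of s])
      fix i assume "i < n - 1"
      then show "\<not> (x \<in> f (cyc (s + i)) ` F \<and> x \<in> f (cyc (s + Suc i)) ` F)"
        using out[of i] out[of "Suc i"] three_le by (cases i) auto
    qed
  next
    case False
    show thesis
    proof (rule that[of 0])
      fix i assume "i < n - 1"
      then have "cyc (0 + i) \<noteq> cyc (0 + Suc i)"
        using cyc_inj[of 0 i "Suc i"] by (metis Suc_lessD less_diff_conv n_not_Suc_n Suc_eq_plus1)
      then show "\<not> (x \<in> f (cyc (0 + i)) ` F \<and> x \<in> f (cyc (0 + Suc i)) ` F)"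
        using False cyc_in by blast
    qed
  qed
  have "connected (\<Union>i\<le>n - 1. f (cyc (s + i)) ` F - {x})"
  proof (rule connected_chain)
    show "connected (f (cyc (s + i)) ` F - {x})" for i using con cyc_in by blast
    show "(f (cyc (s + i)) ` F - {x}) \<inter> (f (cyc (s + Suc i)) ` F - {x}) \<noteq> {}" if "i < n - 1" for i
      using cyc_meet[of "s + i"] s[OF that] by auto
  qed
  also have "(\<Union>i\<le>n - 1. f (cyc (s + i)) ` F - {x}) = (\<Union>k\<in>(\<lambda>i. cyc (s + i)) ` {..<n}. f k ` F) - {x}"
    using three_le by (auto simp: lessThan_Suc_atMost[symmetric])
  also have "\<dots> = F - {x}" using F_eq cyc_range by simp
  finally show ?thesis .
qed

section \<open>Paths that avoid the contacts\<close>

text \<open>Stability keeps the pulled-back clopen set away from the other pieces at every level, while its distance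
  from the removed point grows geometrically.\<close>

lemma nonbranching_path_connected_delete:
  assumes st: "stable_necklace n f F"
    and \<kappa>: "\<And>m. \<kappa> m \<in> {1..n}" and xF: "\<And>m. x m \<in> F"
    and step: "\<And>m. x m = f (\<kappa> m) (x (Suc m))"
    and only: "\<And>m. x m \<notin> other_pieces (\<kappa> m)"
  shows "connected (F - {x 0})"
proof (rule ccontr)
  assume "\<not> connected (F - {x 0})"
  then obtain C where C: "openin (top_of_set (F - {x 0})) C" "closedin (top_of_set (F - {x 0})) C"
    "C \<noteq> {}" "C \<noteq> F - {x 0}"
    by (auto simp: connected_clopen)
  obtain a b where ab: "b < 1" "0 < b" "\<And>k. k \<in> {1..n} \<Longrightarrow> a \<le> c k \<and> c k \<le> b"
    using ratio_bounds by metis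
  define clopen_at where "clopen_at m C \<longleftrightarrow> openin (top_of_set (F - {x m})) C \<and> closedin (top_of_set (F - {x m})) C" for m C
  have side: "other_pieces (\<kappa> m) \<subseteq> C \<or> other_pieces (\<kappa> m) \<inter> C = {}" if "clopen_at m C" for m C
  proof -
    have "other_pieces (\<kappa> m) \<subseteq> F - {x m}" using other_pieces_subset only by blast
    then show ?thesis
      using connectedin_clopen_cases[of "top_of_set (F - {x m})" "other_pieces (\<kappa> m)" C] that connected_other_pieces[OF \<kappa>]
      by (auto simp: clopen_at_def disjnt_def connectedin_subtopology)
  qed
  \<comment> \<open>Of a clopen set and its complement, one avoids the connected union of the other pieces.\<close>
  obtain D z where D: "clopen_at 0 D" "z \<in> D" "D \<inter> other_pieces (\<kappa> 0) = {}"
  proof (cases "other_pieces (\<kappa> 0) \<subseteq> C")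
    case True
    have "clopen_at 0 (F - {x 0} - C)"
      using C by (auto simp: clopen_at_def openin_diff closedin_diff)
    moreover obtain z where "z \<in> F - {x 0} - C" 
      using C by (metis Diff_eq_empty_iff equals0I openin_imp_subset subset_antisym)
    ultimately show ?thesis using that True by blast
  next
    case False
    then show ?thesis using side[of 0 C] C that[of C] by (auto simp: clopen_at_def)
  qed
  define d where "d = dist z (x 0)"
  have "z \<in> F - {x 0}" using D openin_imp_subset unfolding clopen_at_def by blast
  then have dpos: "d > 0" by (simp add: d_def)
  have far: "\<exists>D z. clopen_at m D \<and> z \<in> D \<and> D \<inter> other_pieces (\<kappa> m) = {} \<and> d / b ^ m \<le> dist z (x m)" for m
  proof (induction m)
    case 0
    then show ?case using D by (auto simp: d_def)
  next
    case (Suc m)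
    then obtain D z where D: "clopen_at m D" "z \<in> D" "D \<inter> other_pieces (\<kappa> m) = {}" "d / b ^ m \<le> dist z (x m)"
      by blast
    let ?k = "\<kappa> m" and ?l = "\<kappa> (Suc m)"
    define D' where "D' = (F - {x (Suc m)}) \<inter> f ?k -` D"
    have maps: "f ?k \<in> (F - {x (Suc m)}) \<rightarrow> F - {x m}"
    proof
      fix y assume y: "y \<in> F - {x (Suc m)}"
      then have "f ?k y \<noteq> x m" using injD[OF inj_f[OF \<kappa>]] step[of m] by (metis DiffD2 singletonI)
      then show "f ?k y \<in> F - {x m}" using y piece_subset[OF \<kappa>] by blast
    qed
    have clopen_at': "clopen_at (Suc m) D'"
      using D(1) continuous_openin_preimage[OF continuous_f[OF \<kappa>] maps]
        continuous_closedin_preimage_gen[OF continuous_f[OF \<kappa>] maps]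
      unfolding clopen_at_def D'_def by blast
    have DF: "D \<subseteq> F - {x m}" using D(1) openin_imp_subset unfolding clopen_at_def by blast
    then obtain z' where z': "z' \<in> F" "z = f ?k z'"
      using D F_split[OF \<kappa>[of m]] by blast
    have "z' \<in> D'" using z' D DF step[of m] by (auto simp: D'_def)
    moreover have "D' \<inter> other_pieces ?l = {}"
    proof -
      obtain y where "y \<in> other_pieces ?l" "f ?k y \<in> other_pieces ?k"
        using stable_reaches_other_pieces[OF st \<kappa>] by blast
      then have "\<not> other_pieces ?l \<subseteq> D'" using D(3) by (auto simp: D'_def)
      then show ?thesis using side[OF clopen_at'] by blast
    qed
    moreover have "d / b ^ Suc m \<le> dist z' (x (Suc m))"
    proof -
      have "d / b ^ m \<le> dist (f ?k z') (f ?k (x (Suc m)))" using D(4) z' step[of m] by simp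
      also have "\<dots> \<le> b * dist z' (x (Suc m))"
        using ab(3)[OF \<kappa>] by (simp add: dist_f[OF \<kappa>] mult_right_mono)
      finally show ?thesis using ab by (simp add: field_simps)
    qed
    ultimately show ?case using clopen_at' by blast
  qed
  have "\<exists>z\<in>F. \<exists>y\<in>F. d / b ^ m \<le> dist z y" for m
  proof -
    obtain D z where "clopen_at m D" "z \<in> D" "d / b ^ m \<le> dist z (x m)"
      using far[of m] by blast
    moreover from this have "z \<in> F" using openin_imp_subset unfolding clopen_at_def by blast
    ultimately show ?thesis using xF by blast
  qed
  then show False
    by (rule bounded_expanding_False[OF compact_imp_bounded[OF compact_F] \<open>0 < b\<close> \<open>b < 1\<close> dpos])
qed

section \<open>The open set condition bounds the number of addresses\<close>

text \<open>A word \<open>[k1, \<dots>, kr]\<close> of indices stands for the similitude \<open>foldr f [k1, \<dots>, kr] = f k1 \<circ> \<dots> \<circ> f kr\<close>.\<close>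

abbreviation word_ratio :: "nat list \<Rightarrow> real" where
  "word_ratio w \<equiv> prod_list (map c w)"

lemma ratio_word_pos: "set w \<subseteq> {1..n} \<Longrightarrow> 0 < word_ratio w"
  by (induction w) (auto simp: ratio_pos)

lemma dist_word: "set w \<subseteq> {1..n} \<Longrightarrow> dist (foldr f w x) (foldr f w y) = word_ratio w * dist x y"
  by (induction w) (auto simp: dist_f)

lemma surj_word: "set w \<subseteq> {1..n} \<Longrightarrow> surj (foldr f w)"
proof (induction w)
  case (Cons k w)
  then show ?case using surj_f[of k] by (auto simp: comp_surj simp del: o_apply)
qed (simp add: surj_def)

lemma inj_word: "set w \<subseteq> {1..n} \<Longrightarrow> inj (foldr f w)"
proof (induction w)
  case (Cons k w)
  then show ?case using inj_compose[of "f k" "foldr f w"] inj_f[of k] by (simp add: comp_def)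
qed (simp add: inj_on_def)

text \<open>Following an address of \<open>y\<close> until the ratio first drops to \<open>t\<close> or below overshoots by at most one
  factor, hence by at most \<open>a\<close>.\<close>

lemma word_of_size:
  assumes amin: "\<And>k. k \<in> {1..n} \<Longrightarrow> a \<le> c k"
    and y: "y \<in> F" and t: "0 < t" "t \<le> 1"
  shows "\<exists>w z. set w \<subseteq> {1..n} \<and> z \<in> F \<and> y = foldr f w z \<and> a * t \<le> word_ratio w \<and> word_ratio w \<le> t"
proof -
  obtain a' b where ab: "b < 1" "0 < b" "\<And>k. k \<in> {1..n} \<Longrightarrow> a' \<le> c k \<and> c k \<le> b"
    using ratio_bounds by metis
  have one: "1 \<in> {1..n}" using three_le by simp
  have a1: "a \<le> 1" using amin[OF one] ratio_less[OF one] by simp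
  \<comment> \<open>The induction is on the number \<open>N\<close> of steps that certainly suffice, for all \<open>y\<close> and \<open>t\<close> at once.\<close>
  have "\<exists>w z. set w \<subseteq> {1..n} \<and> z \<in> F \<and> y = foldr f w z \<and> a * t \<le> word_ratio w \<and> word_ratio w \<le> t"
    if "b ^ N \<le> t" "t \<le> 1" "y \<in> F" for N y t
    using that
  proof (induction N arbitrary: y t)
    case 0
    then have "t = 1" by simp
    then show ?case using 0 a1 by (intro exI[of _ "[]"]) auto
  next
    case (Suc N)
    obtain k y' where k: "k \<in> {1..n}" "y' \<in> F" "y = f k y'" using Suc.prems(3) mem_F_iff by blast
    have ck: "0 < c k" by (rule ratio_pos[OF k(1)])
    have tpos: "0 < t" using Suc.prems(1) ab(2) by (meson less_le_trans zero_less_power)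
    show ?case
    proof (cases "t \<le> c k")
      case True
      have "b ^ N * c k \<le> b ^ N * b" using ab(3)[OF k(1)] ab(2) by (intro mult_left_mono) auto
      then have "b ^ N * c k \<le> t" using Suc.prems(1) by (simp add: mult.commute)
      then have "b ^ N \<le> t / c k" using ck by (simp add: field_simps)
      moreover have "t / c k \<le> 1" using True ck by (simp add: field_simps)
      ultimately obtain w z where w: "set w \<subseteq> {1..n}" "z \<in> F" "y' = foldr f w z"
        "a * (t / c k) \<le> word_ratio w" "word_ratio w \<le> t / c k"
        using Suc.IH[of "t / c k" y'] k(2) by blast
      then show ?thesis
        using k ck by (intro exI[of _ "k # w"] exI[of _ z]) (auto simp: field_simps)
    next
      case False
      have "a * t \<le> c k"
      proof (cases "a \<le> 0")
        case True
        then have "a * t \<le> 0" using tpos by (simp add: mult_nonpos_nonneg)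
        then show ?thesis using ck by linarith
      next
        case False
        then have "a * t \<le> a" using Suc.prems(2) by (simp add: mult_left_le)
        then show ?thesis using amin[OF k(1)] by linarith
      qed
      then show ?thesis
        using k False by (intro exI[of _ "[k]"] exI[of _ y']) auto
    qed
  qed
  moreover obtain N where "b ^ N < t" using real_arch_pow_inv[OF t(1) ab(1)] by blast
  ultimately show ?thesis using y t by (meson less_imp_le)
qed

text \<open>The branchings give words \<open>u m\<close>, one for each branching level, none of which is a prefix of another. They are
  prolonged to words \<open>W m\<close> of ratio about \<open>r\<close> whose pieces still contain \<open>x 0\<close>. Taking a base point \<open>v\<close> of the open
  set, the points \<open>foldr f (W m) v\<close>, rescaled by \<open>r\<close> about \<open>x 0\<close>, are uniformly separated and bounded, with
  constants that depend neither on \<open>r\<close> nor on the number of words.\<close>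

lemma finitely_many_branchings:
  assumes osc: "open_set_condition n f"
    and \<kappa>: "\<And>m. \<kappa> m \<in> {1..n}" and xF: "\<And>m. x m \<in> F"
    and step: "\<And>m. x m = f (\<kappa> m) (x (Suc m))"
  shows "finite {m. x m \<in> other_pieces (\<kappa> m)}"
proof (rule ccontr)
  define H where "H = {m. x m \<in> other_pieces (\<kappa> m)}"
  assume "infinite {m. x m \<in> other_pieces (\<kappa> m)}"
  then have infH: "infinite H" by (simp add: H_def)
  obtain V where V: "V \<noteq> {}" "open V" "\<And>k. k \<in> {1..n} \<Longrightarrow> f k ` V \<subseteq> V"
    and disj: "disjoint_family_on (\<lambda>k. f k ` V) {1..n}"
    using osc unfolding open_set_condition_def by metis
  obtain v \<rho> where v: "\<rho> > 0" "ball v \<rho> \<subseteq> V"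
    using V(1,2) by (meson ex_in_conv open_contains_ball)
  then have vV: "v \<in> V" by auto
  obtain R where R: "\<And>z. z \<in> F \<Longrightarrow> dist v z \<le> R"
    using compact_imp_bounded[OF compact_F] by (meson bounded_any_center)
  obtain a b where ab: "0 < a" "\<And>k. k \<in> {1..n} \<Longrightarrow> a \<le> c k \<and> c k \<le> b"
    using ratio_bounds by metis
  obtain M where M: "\<And>T g. \<lbrakk>finite T; \<And>s. s \<in> T \<Longrightarrow> g s \<in> cball (0::'a) R;
      \<And>s t. \<lbrakk>s \<in> T; t \<in> T; s \<noteq> t\<rbrakk> \<Longrightarrow> a * \<rho> \<le> dist (g s) (g t)\<rbrakk> \<Longrightarrow> card (T::nat set) \<le> M"
    using compact_separated_card_bounded[OF compact_cball, of "a * \<rho>" 0 R] ab(1) v(1) by (metis mult_pos_pos)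
  obtain T where T: "T \<subseteq> H" "finite T" "card T = Suc M"
    using infinite_arbitrarily_large[OF infH] by metis
  define pre where "pre m = map \<kappa> [0..<m]" for m
  have pre_set: "set (pre m) \<subseteq> {1..n}" for m using \<kappa> by (auto simp: pre_def)
  have x0: "x 0 = foldr f (pre m) (x m)" for m
    by (induction m) (simp_all add: pre_def step[symmetric])
  have "\<forall>m\<in>H. \<exists>k y. k \<in> {1..n} \<and> k \<noteq> \<kappa> m \<and> y \<in> F \<and> x m = f k y"
    by (auto simp: H_def other_pieces_def)
  then obtain k y where ky: "\<And>m. m \<in> H \<Longrightarrow> k m \<in> {1..n} \<and> k m \<noteq> \<kappa> m \<and> y m \<in> F \<and> x m = f (k m) (y m)"
    by metis
  define u where "u m = pre m @ [k m]" for m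
  have u_set: "set (u m) \<subseteq> {1..n}" if "m \<in> T" for m
    using pre_set ky T(1) that by (auto simp: u_def)
  \<comment> \<open>A size not exceeding that of any of the chosen words, so that each can be prolonged down to it.\<close>
  define r where "r = Min ((\<lambda>m. word_ratio (u m)) ` T)"
  have "T \<noteq> {}" using T(3) by auto
  then have r: "0 < r" "\<And>m. m \<in> T \<Longrightarrow> r \<le> word_ratio (u m)"
    using T(2) u_set ratio_word_pos by (auto simp: r_def)
  have "\<exists>w z. set w \<subseteq> {1..n} \<and> z \<in> F \<and> y m = foldr f w z \<and> a * (r / word_ratio (u m)) \<le> word_ratio w \<and> word_ratio w \<le> r / word_ratio (u m)"
    if "m \<in> T" for m
    using that r ratio_word_pos[OF u_set[OF that]] ab(2) ky T(1) by (intro word_of_size) auto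
  then obtain w z where wz: "\<And>m. m \<in> T \<Longrightarrow> set (w m) \<subseteq> {1..n} \<and> z m \<in> F \<and> y m = foldr f (w m) (z m) \<and>
      a * (r / word_ratio (u m)) \<le> word_ratio (w m) \<and> word_ratio (w m) \<le> r / word_ratio (u m)"
    by metis
  define W where "W m = u m @ w m" for m
  have W_set: "set (W m) \<subseteq> {1..n}" if "m \<in> T" for m
    using u_set wz that by (auto simp: W_def)
  have W_ratio: "a * r \<le> word_ratio (W m)" "word_ratio (W m) \<le> r" if "m \<in> T" for m
    using wz[OF that] ratio_word_pos[OF u_set[OF that]] by (simp_all add: W_def field_simps)
  have xW: "x 0 = foldr f (W m) (z m)" if "m \<in> T" for m
    using x0[of m] ky[of m] wz[OF that] T(1) that by (auto simp: W_def u_def)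
  have word_V: "foldr f w p \<in> V" if "set w \<subseteq> {1..n}" "p \<in> V" for w p
    using that V(3) by (induction w) auto
  \<comment> \<open>For \<open>s < t\<close> the word \<open>W t\<close> still follows the path at level \<open>s\<close>, where \<open>W s\<close> has left it.\<close>
  have W_apart: "foldr f (W s) p \<noteq> foldr f (W t) q" if st: "s \<in> T" "t \<in> T" "s < t" and pq: "p \<in> V" "q \<in> V" for s t p q
  proof
    assume eq: "foldr f (W s) p = foldr f (W t) q"
    have "[0..<t] = [0..<s] @ s # [Suc s..<t]"
      using st(3) by (metis less_imp_add_positive upt_add_eq_append upt_conv_Cons zero_le less_imp_le_nat le_add_diff_inverse)
    then have Wt: "W t = pre s @ \<kappa> s # (map \<kappa> [Suc s..<t] @ k t # w t)"
      by (simp add: W_def u_def pre_def)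
    have Ws: "W s = pre s @ k s # w s" by (simp add: W_def u_def)
    define p' where "p' = foldr f (w s) p"
    define q' where "q' = foldr f (map \<kappa> [Suc s..<t] @ k t # w t) q"
    have "p' \<in> V" "q' \<in> V"
      unfolding p'_def q'_def using W_set[OF st(1)] W_set[OF st(2)] pq
      by (intro word_V; simp add: Ws Wt)+
    moreover have "f (k s) p' = f (\<kappa> s) q'"
      using eq inj_word[OF pre_set[of s]] unfolding Ws Wt p'_def q'_def by (auto dest: injD)
    moreover have "f (k s) ` V \<inter> f (\<kappa> s) ` V = {}"
      using disj ky[OF subsetD[OF T(1) st(1)]] \<kappa>[of s] unfolding disjoint_family_on_def by metis
    ultimately show False by blast
  qed
  define g where "g m = (foldr f (W m) v - x 0) /\<^sub>R r" for m
  have g_in: "g m \<in> cball 0 R" if "m \<in> T" for m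
  proof -
    have zF: "z m \<in> F" using wz that by blast
    have "dist (foldr f (W m) v) (x 0) = word_ratio (W m) * dist v (z m)"
      using xW[OF that] dist_word[OF W_set[OF that]] by simp
    also have "\<dots> \<le> r * R"
      using W_ratio[OF that] R[OF zF] r(1) by (intro mult_mono) auto
    finally have "norm (foldr f (W m) v - x 0) / r \<le> R"
      using r(1) by (simp add: dist_norm pos_divide_le_eq mult.commute)
    moreover have "norm (g m) = norm (foldr f (W m) v - x 0) / r"
      using r(1) by (simp add: g_def divide_inverse_commute)
    ultimately show ?thesis by simp
  qed
  have g_sep: "a * \<rho> \<le> dist (g s) (g t)" if st: "s \<in> T" "t \<in> T" "s \<noteq> t" for s t
  proof -
    have "word_ratio (W s) * \<rho> \<le> dist (foldr f (W s) v) (foldr f (W t) v)"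
    proof (rule ccontr)
      assume close: "\<not> ?thesis"
      obtain p where p: "foldr f (W t) v = foldr f (W s) p"
        using surj_word[OF W_set[OF st(1)]] by (metis surjD)
      have "dist v p < \<rho>"
        using close ratio_word_pos[OF W_set[OF st(1)]] by (simp add: p dist_word[OF W_set[OF st(1)]])
      then have "p \<in> V" using v(2) by auto
      then show False
        using W_apart[of s t p v] W_apart[of t s v p] st p vV by (metis linorder_neqE_nat)
    qed
    moreover have "a * r * \<rho> \<le> word_ratio (W s) * \<rho>"
      using W_ratio[OF st(1)] v(1) by simp
    moreover have "dist (g s) (g t) = dist (foldr f (W s) v) (foldr f (W t) v) / r"
    proof -
      have "g s - g t = (foldr f (W s) v - foldr f (W t) v) /\<^sub>R r"
        by (simp add: g_def scaleR_diff_right)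
      then show ?thesis using r(1) by (simp add: dist_norm divide_inverse_commute)
    qed
    ultimately have "a * \<rho> * r \<le> dist (g s) (g t) * r"
      using r(1) by (simp add: mult.commute mult.left_commute)
    then show ?thesis using r(1) by simp
  qed
  have "card T \<le> M" by (rule M[OF T(2) g_in g_sep])
  then show False using T(3) by simp
qed

section \<open>Absence of cut points\<close>

text \<open>By choice, a point whose removal disconnects \<open>F\<close> starts a path of such points; the tail of the path beyond
  its last branching contradicts the result on paths that avoid the contacts.\<close>

lemma stable_connected_delete:
  assumes st: "stable_necklace n f F" and osc: "open_set_condition n f" and "x \<in> F"
  shows "connected (F - {x})"
proof (rule ccontr)
  assume bad: "\<not> connected (F - {x})"
  define X where "X = {x \<in> F. \<not> connected (F - {x})}"
  have "\<forall>x\<in>X. \<exists>y k. y \<in> X \<and> k \<in> {1..n} \<and> x = f k y"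
  proof
    fix z assume "z \<in> X"
    then have "\<not> connected (F - {z})" by (simp add: X_def)
    then obtain k y where "k \<in> {1..n}" "y \<in> F" "f k y = z" "\<not> connected (F - {y})"
      using connected_delete_if_pieces[OF st, of z] by metis
    then show "\<exists>y k. y \<in> X \<and> k \<in> {1..n} \<and> z = f k y" by (auto simp: X_def)
  qed
  then obtain Y K where YK: "\<And>x. x \<in> X \<Longrightarrow> Y x \<in> X \<and> K x \<in> {1..n} \<and> x = f (K x) (Y x)"
    by metis
  define p where "p m = (Y ^^ m) x" for m
  have pX: "p m \<in> X" for m
    by (induction m) (use bad assms(3) YK in \<open>auto simp: p_def X_def\<close>)
  define \<kappa> where "\<kappa> m = K (p m)" for m
  have \<kappa>: "\<kappa> m \<in> {1..n}" and step: "p m = f (\<kappa> m) (p (Suc m))" and pF: "p m \<in> F" for m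
    using YK[OF pX[of m]] pX[of m] by (auto simp: \<kappa>_def p_def X_def)
  have "finite {m. p m \<in> other_pieces (\<kappa> m)}"
    by (rule finitely_many_branchings[where \<kappa> = \<kappa> and x = p]) (fact osc \<kappa> pF step)+
  then obtain N where N: "\<And>m. p m \<in> other_pieces (\<kappa> m) \<Longrightarrow> m < N"
    by (metis (no_types, lifting) finite_nat_set_iff_bounded mem_Collect_eq)
  have "connected (F - {p (N + 0)})"
  proof (rule nonbranching_path_connected_delete[OF st, where \<kappa> = "\<lambda>m. \<kappa> (N + m)" and x = "\<lambda>m. p (N + m)"])
    show "p (N + m) \<notin> other_pieces (\<kappa> (N + m))" for m using N[of "N + m"] by auto
    show "p (N + m) = f (\<kappa> (N + m)) (p (N + Suc m))" for m using step[of "N + m"] by simp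
  qed (fact \<kappa> pF)+
  then show False using pX[of N] by (simp add: X_def)
qed

end

theorem theorem3:
  fixes f :: "nat \<Rightarrow> 'a::euclidean_space \<Rightarrow> 'a" and n :: nat and F :: "'a set"
  assumes "2 \<le> DIM('a)"
    and "self_similar_necklace_IFS n f F"
    and "open_set_condition n f"
    and "stable_necklace n f F"
  shows "\<not> (\<exists>x. is_cut_point x F)"
proof -
  have neck: "necklace_IFS n f F" and "\<forall>k\<in>{1..n}. similitude (f k)"
    using assms(2) by (auto simp: self_similar_necklace_IFS_def)
  then obtain c where c: "\<And>k. k \<in> {1..n} \<Longrightarrow> 0 < c k \<and> c k < 1 \<and> (\<forall>x y. dist (f k x) (f k y) = c k * dist x y)"
    unfolding similitude_def by metis
  have n3: "3 \<le> n"
    and homeo: "\<And>k. k \<in> {1..n} \<Longrightarrow> \<exists>g. homeomorphism UNIV UNIV (f k) g"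
    and attr: "F \<noteq> {}" "compact F" "F = (\<Union>k\<in>{1..n}. f k ` F)"
    and adj: "\<And>m k. \<lbrakk>m \<in> {1..n}; k \<in> {1..n}; m \<noteq> k; \<bar>int m - int k\<bar> = 1 \<or> \<bar>int m - int k\<bar> = int n - 1\<rbrakk>
      \<Longrightarrow> is_singleton (f m ` F \<inter> f k ` F)"
    and nonadj: "\<And>m k. \<lbrakk>m \<in> {1..n}; k \<in> {1..n}; m \<noteq> k; 2 \<le> \<bar>int m - int k\<bar>; \<bar>int m - int k\<bar> \<le> int n - 2\<rbrakk>
      \<Longrightarrow> f m ` F \<inter> f k ` F = {}"
    using neck unfolding necklace_IFS_def is_attractor_def by metis+
  interpret similarity_necklace n f F c
  proof
    show "surj (f k)" if "k \<in> {1..n}" for k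
      using homeo[OF that] by (auto simp: homeomorphism_def)
    show "is_singleton (f m ` F \<inter> f k ` F)"
      if "m \<in> {1..n}" "k \<in> {1..n}" "\<bar>int m - int k\<bar> = 1 \<or> \<bar>int m - int k\<bar> = int n - 1" for m k
    proof (rule adj[OF that(1,2) _ that(3)])
      show "m \<noteq> k" using that(3) n3 by auto
    qed
    show "f m ` F \<inter> f k ` F = {}"
      if "m \<in> {1..n}" "k \<in> {1..n}" "2 \<le> \<bar>int m - int k\<bar>" "\<bar>int m - int k\<bar> \<le> int n - 2" for m k
    proof (rule nonadj[OF that(1,2) _ that(3,4)])
      show "m \<noteq> k" using that(3) by auto
    qed
    show "F = (\<Union>k\<in>{1..n}. f k ` F)" by (rule attr(3))
  qed (use c n3 attr(1,2) in \<open>simp_all\<close>)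
  show ?thesis
    using stable_connected_delete[OF assms(4,3)] unfolding is_cut_point_def by blast
qed

end
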